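(* For positive integers $r, k$ define $$S_{r,k} := \sum_{n=1}^{+\infty} \frac{(-1)^{(r-1)(n-1)}}{F_{rn} F_{r(n+k)}}.$$ Then for every positive integer $r$ and every odd positive integer $k$, $$S_{r,k} = \frac{F_r}{F_{rk}}\left(S_{r,1} + (-1)^r \sum_{n=1}^{(k-1)/2} \frac{1}{F_{2nr} F_{(2n+1)r}}\right).$$
   Context: $(F_n)$ is the Fibonacci sequence: $F_0 = 0$, $F_1 = 1$, $F_{n+2} = F_{n+1} + F_n$. An empty sum equals $0$. *)

theory Defs
  imports "HOL-Analysis.Analysis" "HOL-Number_Theory.Fib"
begin

text \<open>
  The index of \<^const>\<open>suminf\<close> starts at 0, so the term with index \<open>n \<ge> 1\<close> is taken at
  \<open>Suc n\<close>.  For positive \<open>r\<close> and \<open>n\<close> the subtractions in the exponent do not truncate.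
\<close>

definition S_term :: "nat \<Rightarrow> nat \<Rightarrow> nat \<Rightarrow> real" where
  "S_term r k n = (-1) ^ ((r - 1) * (n - 1)) / (real (fib (r * n)) * real (fib (r * (n + k))))"

definition S :: "nat \<Rightarrow> nat \<Rightarrow> real" where
  "S r k = (\<Sum>n. S_term r k (Suc n))"

lemma fib_ge_half: "n \<le> 2 * fib n"
proof (induction n rule: fib.induct)
  case (3 n)
  then show ?case
    by (cases n) auto
qed auto

text \<open>The series converges, so the value of \<^const>\<open>suminf\<close> in \<^const>\<open>S\<close> is its sum.\<close>

lemma summable_S_term:
  assumes "r > 0" "k > 0"
  shows "summable (\<lambda>n. S_term r k (Suc n))"
proof (rule summable_comparison_test')
  show "summable (\<lambda>n. 4 * inverse ((real (Suc n))\<^sup>2))"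
    using inverse_power_summable[of 2, where 'a = real]
    by (intro summable_mult) (subst summable_Suc_iff, simp)
next
  fix n :: nat
  have *: "real (Suc n) / 2 \<le> real (fib m)" if "Suc n \<le> m" for m
  proof -
    have "Suc n \<le> 2 * fib m"
      using fib_ge_half[of m] that by linarith
    then have "real (Suc n) \<le> real (2 * fib m)"
      by (simp only: of_nat_le_iff)
    then show ?thesis
      by simp
  qed
  have "Suc n \<le> r * Suc n" "Suc n \<le> r * (Suc n + k)"
    using assms by (cases r; simp)+
  then have "real (Suc n) / 2 * (real (Suc n) / 2)
      \<le> real (fib (r * Suc n)) * real (fib (r * (Suc n + k)))"
    by (intro mult_mono *) auto
  then have "1 / (real (fib (r * Suc n)) * real (fib (r * (Suc n + k))))
      \<le> 1 / (real (Suc n) / 2 * (real (Suc n) / 2))"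
    by (intro divide_left_mono mult_pos_pos) (use assms in \<open>auto simp: fib_neq_0_nat\<close>)
  also have "\<dots> = 4 * inverse ((real (Suc n))\<^sup>2)"
    by (simp add: field_simps power2_eq_square)
  finally show "norm (S_term r k (Suc n)) \<le> 4 * inverse ((real (Suc n))\<^sup>2)"
    by (simp add: S_term_def norm_divide norm_mult norm_power del: of_nat_Suc)
qed

end

theory Submission
  imports Defs
begin

text \<open>
  Write \<open>a n = F (r n)\<close> and \<open>c n = a (n + 1) / a n\<close>. Vajda's identity turns each term of \<open>S r k\<close>
  into a constant multiple of \<open>(-1) ^ n (c n - c (n + k))\<close>. The alternating sign prevents
  telescoping of the series itself, but in \<open>a (k + 2) S r (k + 2) - a k S r k\<close> the terms become
  multiples of \<open>(-1) ^ n (c (n + k) - c (n + k + 2))\<close>, and these do telescope, because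
  \<open>(-1) ^ n (c n - c (n + 1))\<close> is a constant multiple of the \<open>n\<close>-th term of \<open>S r 1\<close>.
  The theorem follows by induction from \<open>k\<close> to \<open>k + 2\<close>.
\<close>

text \<open>By the recurrence, raising \<open>n\<close> by one negates the left side, which equals
  \<open>fib j\<close> at \<open>n = 0\<close>. This is the case \<open>i = 1\<close> of
  \<open>fib_Vajda\<close>.\<close>

lemma fib_d'Ocagne:
  "real (fib (Suc n)) * real (fib (n + j)) - real (fib n) * real (fib (Suc (n + j)))
     = (-1) ^ n * real (fib j)"
proof (induction n)
  case (Suc n)
  have "real (fib (Suc (Suc n))) * real (fib (Suc n + j))
          - real (fib (Suc n)) * real (fib (Suc (Suc n + j)))
      = - (real (fib (Suc n)) * real (fib (n + j)) - real (fib n) * real (fib (Suc (n + j))))"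
    by (simp add: algebra_simps)
  then show ?case
    using Suc.IH by simp
qed simp

text \<open>For fixed \<open>n\<close> and \<open>j\<close>, both sides satisfy the Fibonacci
  recurrence in \<open>i\<close>, so agreement at \<open>i = 0\<close> and \<open>i = 1\<close>
  suffices.\<close>

lemma fib_Vajda:
  "real (fib (n + i)) * real (fib (n + j)) - real (fib n) * real (fib (n + i + j))
     = (-1) ^ n * real (fib i) * real (fib j)"
proof (induction i rule: fib.induct)
  case 2
  show ?case
    using fib_d'Ocagne[of n j] by simp
next
  case (3 i)
  have "real (fib (n + Suc (Suc i))) = real (fib (n + Suc i)) + real (fib (n + i))"
       "real (fib (n + Suc (Suc i) + j)) = real (fib (n + Suc i + j)) + real (fib (n + i + j))"
       "real (fib (Suc (Suc i))) = real (fib (Suc i)) + real (fib i)"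
    by simp_all
  then show ?case
    using 3 by (simp only: algebra_simps)
qed simp

lemma S_term_eq_diff_fib_ratio:
  assumes "r > 0" "n > 0"
  shows "real (fib r) * real (fib (r * k)) * S_term r k n
     = (-1) ^ (r + n + 1) *
       (real (fib (r * (n + 1))) / real (fib (r * n))
        - real (fib (r * (n + k + 1))) / real (fib (r * (n + k))))"
proof -
  \<comment> \<open>Expanding gives \<open>r * n - r - n + 1\<close>, and signs do not affect
    parity. The factor \<open>(-1) ^ (r * n)\<close> is the one that Vajda's identity
    produces.\<close>
  have "even ((r - 1) * (n - 1)) \<longleftrightarrow> even (r + n + 1 + r * n)"
    using assms by (auto simp: even_mult_iff)
  then have sgn: "(-1 :: real) ^ ((r - 1) * (n - 1)) = (-1) ^ (r + n + 1) * (-1) ^ (r * n)"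
    unfolding power_add[symmetric] by (simp only: minus_one_power_iff)
  have pos: "real (fib (r * n)) > 0" "real (fib (r * (n + k))) > 0"
    using assms by (auto simp: fib_neq_0_nat)
  have V: "real (fib (r * (n + 1))) * real (fib (r * (n + k)))
        - real (fib (r * n)) * real (fib (r * (n + k + 1)))
      = (-1) ^ (r * n) * real (fib r) * real (fib (r * k))"
    using fib_Vajda[of "r * n" r "r * k"] by (simp add: algebra_simps)
  have "real (fib (r * (n + 1))) / real (fib (r * n))
        - real (fib (r * (n + k + 1))) / real (fib (r * (n + k)))
      = ((-1) ^ (r * n) * real (fib r) * real (fib (r * k)))
        / (real (fib (r * n)) * real (fib (r * (n + k))))"
    unfolding V[symmetric] using pos by (simp add: field_simps)
  then show ?thesis
    unfolding S_term_def sgn by simp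
qed

lemma S_term_step:
  assumes "r > 0" "n > 0"
  shows "real (fib (r * (k + 2))) * S_term r (k + 2) n - real (fib (r * k)) * S_term r k n
     = (-1) ^ k * real (fib r) * (S_term r 1 (n + k) - S_term r 1 (Suc (n + k)))"
proof -
  define c where "c m = real (fib (r * (m + 1))) / real (fib (r * m))" for m
  have eq: "real (fib r) * real (fib (r * k)) * S_term r k n
      = (-1) ^ (r + n + 1) * (c n - c (n + k))" if "n > 0" for n k
    using S_term_eq_diff_fib_ratio[OF \<open>r > 0\<close> that, of k] by (simp add: c_def)
  have sq: "(-1 :: real) ^ m * (-1) ^ m = 1" for m
    by (simp flip: power_add)
  \<comment> \<open>This is \<open>eq\<close> at shift 1, solved for the difference: the sign is its
    own inverse.\<close>
  have t: "c m - c (Suc m) = (-1) ^ (r + m + 1) * (real (fib r) * real (fib r) * S_term r 1 m)"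
    if "m > 0" for m
    using eq[OF that, of 1] sq[of "r + m + 1"] by (simp flip: mult.assoc)
  \<comment> \<open>The \<open>c n\<close> parts cancel. Inserting \<open>c (Suc (n + k))\<close>
    splits the rest into two adjacent differences, to which \<open>t\<close> applies with opposite
    signs.\<close>
  have "real (fib r) * (real (fib (r * (k + 2))) * S_term r (k + 2) n
          - real (fib (r * k)) * S_term r k n)
      = (-1) ^ (r + n + 1) * ((c (n + k) - c (Suc (n + k)))
          + (c (Suc (n + k)) - c (Suc (Suc (n + k)))))"
    using eq[OF \<open>n > 0\<close>, of "k + 2"] eq[OF \<open>n > 0\<close>, of k] by (simp add: algebra_simps)
  also have "\<dots> = ((-1) ^ (r + n + 1) * (-1) ^ (r + n + 1)) * (-1) ^ k * real (fib r) * real (fib r)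
      * (S_term r 1 (n + k) - S_term r 1 (Suc (n + k)))"
    using assms by (simp add: t power_add algebra_simps)
  finally show ?thesis
    unfolding sq using assms fib_neq_0_nat[of r] by simp
qed

text \<open>Summing \<open>S_term_step\<close> over positive \<open>n\<close> telescopes to its
  first term, since the terms of \<open>S r 1\<close> tend to 0.\<close>

lemma S_step:
  assumes "r > 0" "k > 0"
  shows "real (fib (r * (k + 2))) * S r (k + 2) - real (fib (r * k)) * S r k
     = (-1) ^ k * real (fib r) * S_term r 1 (Suc k)"
proof -
  let ?t = "\<lambda>n. S_term r 1 (Suc (n + k))"
  have "(\<lambda>n. S_term r 1 (Suc n)) \<longlonglongrightarrow> 0"
    using summable_S_term[OF assms(1), of 1] by (intro summable_LIMSEQ_zero) simp
  then have "?t \<longlonglongrightarrow> 0"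
    by (rule LIMSEQ_ignore_initial_segment)
  then have "(\<lambda>n. ?t n - ?t (Suc n)) sums (?t 0 - 0)"
    by (rule telescope_sums')
  then have "(\<lambda>n. (-1) ^ k * real (fib r) * (?t n - ?t (Suc n)))
      sums ((-1) ^ k * real (fib r) * ?t 0)"
    by (intro sums_mult) simp
  then have "(\<lambda>n. real (fib (r * (k + 2))) * S_term r (k + 2) (Suc n)
        - real (fib (r * k)) * S_term r k (Suc n)) sums ((-1) ^ k * real (fib r) * ?t 0)"
    using S_term_step[OF \<open>r > 0\<close>, of "Suc n" k for n] by simp
  moreover have "(\<lambda>n. real (fib (r * (k + 2))) * S_term r (k + 2) (Suc n)
        - real (fib (r * k)) * S_term r k (Suc n))
      sums (real (fib (r * (k + 2))) * S r (k + 2) - real (fib (r * k)) * S r k)"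
    unfolding S_def using assms
    by (intro sums_diff sums_mult summable_sums summable_S_term) auto
  ultimately show ?thesis
    using sums_unique2 by fastforce
qed

text \<open>With the denominator cleared, each use of \<open>S_step\<close> at an odd index adds
  exactly one summand.\<close>

lemma fib_mult_S_odd:
  assumes "r > 0"
  shows "real (fib (r * (2 * j + 1))) * S r (2 * j + 1)
     = real (fib r) * (S r 1 + (-1) ^ r *
         (\<Sum>n = 1..j. 1 / (real (fib (2 * n * r)) * real (fib ((2 * n + 1) * r)))))"
proof (induction j)
  case (Suc j)
  \<comment> \<open>As \<open>2 * j + 1\<close> is odd, the exponent has the parity of
    \<open>r - 1\<close>. The minus sign cancels against the factor
    \<open>(-1) ^ (2 * j + 1)\<close> from \<open>S_step\<close>.\<close>
  have "(-1 :: real) ^ ((r - 1) * (2 * j + 1)) = - ((-1) ^ r)"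
    using assms by (simp add: minus_one_power_iff)
  then have "(-1) ^ (2 * j + 1) * S_term r 1 (Suc (2 * j + 1))
      = (-1) ^ r * (1 / (real (fib (2 * Suc j * r)) * real (fib ((2 * Suc j + 1) * r))))"
    by (simp add: S_term_def algebra_simps)
  then have "(-1) ^ (2 * j + 1) * real (fib r) * S_term r 1 (Suc (2 * j + 1))
      = real (fib r) * ((-1) ^ r *
          (1 / (real (fib (2 * Suc j * r)) * real (fib ((2 * Suc j + 1) * r)))))"
    by (metis mult.assoc mult.commute)
  moreover have "2 * Suc j + 1 = 2 * j + 1 + 2"
    by simp
  moreover have "(\<Sum>n = 1..Suc j. 1 / (real (fib (2 * n * r)) * real (fib ((2 * n + 1) * r))))
      = (\<Sum>n = 1..j. 1 / (real (fib (2 * n * r)) * real (fib ((2 * n + 1) * r))))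
        + 1 / (real (fib (2 * Suc j * r)) * real (fib ((2 * Suc j + 1) * r)))"
    by simp
  ultimately show ?case
    using S_step[OF assms, of "2 * j + 1"] Suc.IH
    by (simp only: distrib_left) linarith
qed simp

theorem theorem2p7:
  fixes r k :: nat
  assumes "r > 0" and "k > 0" and "odd k"
  shows "S r k = real (fib r) / real (fib (r * k)) *
           (S r 1 + (-1) ^ r * (\<Sum>n = 1..(k - 1) div 2.
              1 / (real (fib (2 * n * r)) * real (fib ((2 * n + 1) * r)))))"
proof -
  obtain j where k: "k = 2 * j + 1"
    using \<open>odd k\<close> by (rule oddE)
  then have j: "(k - 1) div 2 = j"
    by simp
  have "real (fib (r * k)) \<noteq> 0"
    using assms by (simp add: fib_neq_0_nat)
  then show ?thesis
    using fib_mult_S_odd[OF \<open>r > 0\<close>, of j] unfolding j k[symmetric] by (simp add: field_simps)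
qed

end
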